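(* For every integer $m\ge3$ there exists a polyomino with $n=2m$ tiles that admits exactly one set of $m$ non-attacking rooks.
   Context: A polyomino is a finite union of unit squares (tiles) of the standard grid in $\mathbb{R}^2$ with connected interior. Two tiles of $P$ are in the same row (resp. column) of $P$ if the segment joining their centers is horizontal (resp. vertical) and contained in $P$. A set of rooks on distinct tiles is non-attacking if no two are in the same row or column of $P$. *)

theory Defs imports "HOL-Analysis.Analysis" begin

type_synonym cell = "int \<times> int"

text \<open>The cell \<open>(i, j)\<close> names the closed unit square with lower left corner \<open>(i, j)\<close>.\<close>

definition square :: "cell \<Rightarrow> (real \<times> real) set" where
  "square c = {real_of_int (fst c) .. real_of_int (fst c) + 1}
            \<times> {real_of_int (snd c) .. real_of_int (snd c) + 1}"

definition center :: "cell \<Rightarrow> real \<times> real" where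
  "center c = (real_of_int (fst c) + 1 / 2, real_of_int (snd c) + 1 / 2)"

definition polyomino :: "(real \<times> real) set \<Rightarrow> bool" where
  "polyomino P \<longleftrightarrow>
     (\<exists>T. finite T \<and> P = (\<Union>c\<in>T. square c)) \<and> connected (interior P)"

definition tiles :: "(real \<times> real) set \<Rightarrow> cell set" where
  "tiles P = {c. square c \<subseteq> P}"

definition same_row :: "(real \<times> real) set \<Rightarrow> cell \<Rightarrow> cell \<Rightarrow> bool" where
  "same_row P s t \<longleftrightarrow> snd (center s) = snd (center t)
     \<and> closed_segment (center s) (center t) \<subseteq> P"

definition same_column :: "(real \<times> real) set \<Rightarrow> cell \<Rightarrow> cell \<Rightarrow> bool" where
  "same_column P s t \<longleftrightarrow> fst (center s) = fst (center t)
     \<and> closed_segment (center s) (center t) \<subseteq> P"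

definition nonattacking :: "(real \<times> real) set \<Rightarrow> cell set \<Rightarrow> bool" where
  "nonattacking P R \<longleftrightarrow> R \<subseteq> tiles P
     \<and> (\<forall>s\<in>R. \<forall>t\<in>R. s \<noteq> t \<longrightarrow> \<not> same_row P s t \<and> \<not> same_column P s t)"

end

theory Submission imports Defs begin

text \<open>
  The polyomino consists of the diagonal cells \<open>(i, i)\<close>, the superdiagonal cells \<open>(i, i + 1)\<close>
  and the cell \<open>(0, 2)\<close>, inside an \<open>m\<close> by \<open>m\<close> board. Each line of the board meets it in a
  contiguous run of cells, so \<open>m\<close> non-attacking rooks form a permutation matrix, and a
  permutation matrix that is upper triangular is the identity.
\<close>

section \<open>Regions: their tiles and connectedness of their interiors\<close>

abbreviation region :: "cell set \<Rightarrow> (real \<times> real) set" where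
  "region T \<equiv> (\<Union>c\<in>T. square c)"

lemma center_in_square_iff: "center c \<in> square d \<longleftrightarrow> c = d"
proof
  assume "center c \<in> square d"
  then show "c = d"
    unfolding center_def square_def by (auto intro!: prod_eqI)
qed (auto simp: center_def square_def)

text \<open>The center of a square lies in no other grid square, so a square covered by the region
  has to be one of those that form it.\<close>

lemma tiles_region: "tiles (region T) = T"
proof
  show "tiles (region T) \<subseteq> T"
  proof
    fix c assume "c \<in> tiles (region T)"
    then have "center c \<in> region T"
      using center_in_square_iff[of c c] unfolding tiles_def by blast
    then show "c \<in> T"
      by (auto simp: center_in_square_iff)
  qed
qed (auto simp: tiles_def)

lemma closure_interior_square: "closure (interior (square c)) = square c"
  unfolding square_def by (simp add: interior_Times closure_Times)

lemma interior_square_nonempty: "interior (square c) \<noteq> {}"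
  unfolding square_def by (simp add: interior_Times)

lemma convex_square_Un:
  assumes "d = (fst c + 1, snd c) \<or> d = (fst c, snd c + 1)"
  shows "convex (square c \<union> square d)"
proof -
  have "square c \<union> square d =
      {real_of_int (fst c) .. real_of_int (fst d) + 1}
      \<times> {real_of_int (snd c) .. real_of_int (snd d) + 1}"
    using assms unfolding square_def by auto
  then show ?thesis
    by (simp add: convex_Times)
qed

text \<open>The interior of the domino \<open>square c \<union> square d\<close> overlaps the old
  interior in the interior of \<open>square c\<close>, which makes \<open>?S\<close> connected. The
  new interior may be larger than \<open>?S\<close>, since \<open>d\<close> can also share edges
  with other cells of \<open>T\<close>; it is therefore squeezed between \<open>?S\<close> and its
  closure.\<close>

lemma connected_interior_region_insert:
  assumes conn: "connected (interior (region T))" and "c \<in> T"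
    and adj: "d = (fst c + 1, snd c) \<or> d = (fst c, snd c + 1)"
  shows "connected (interior (region (insert d T)))"
proof -
  let ?D = "interior (square c \<union> square d)"
  let ?S = "interior (region T) \<union> ?D"
  have "interior (square c) \<subseteq> interior (region T) \<inter> ?D"
    using \<open>c \<in> T\<close> by (intro Int_greatest interior_mono) auto
  then have "interior (region T) \<inter> ?D \<noteq> {}"
    using interior_square_nonempty[of c] by blast
  moreover have "connected ?D"
    by (intro convex_connected convex_interior convex_square_Un adj)
  ultimately have "connected ?S"
    using conn by (intro connected_Un) auto
  moreover have "?S \<subseteq> interior (region (insert d T))"
    using \<open>c \<in> T\<close> by (intro Un_least interior_mono) auto
  moreover have "square e \<subseteq> closure ?S" if "e \<in> insert d T" for e
  proof -
    have "interior (square e) \<subseteq> ?S"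
      using that interior_mono[of "square e" "region T"]
        interior_mono[of "square e" "square c \<union> square d"] by blast
    then show ?thesis
      using closure_mono closure_interior_square by metis
  qed
  then have "interior (region (insert d T)) \<subseteq> closure ?S"
    using interior_subset by blast
  ultimately show ?thesis
    by (rule connected_intermediate_closure)
qed

section \<open>Gap-free runs of cells as lines of attack\<close>

lemma same_column_region:
  assumes "fst s = fst t"
    and "\<And>k. min (snd s) (snd t) \<le> k \<Longrightarrow> k \<le> max (snd s) (snd t) \<Longrightarrow> (fst s, k) \<in> T"
  shows "same_column (region T) s t"
proof -
  have "closed_segment (center s) (center t) \<subseteq> region T"
  proof
    fix p assume "p \<in> closed_segment (center s) (center t)"
    then have "fst p \<in> closed_segment (fst (center s)) (fst (center t))"
      and "snd p \<in> closed_segment (snd (center s)) (snd (center t))"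
      using closed_segment_PairD[of "fst p" "snd p"] by (metis prod.collapse)+
    then have fst: "fst p = real_of_int (fst s) + 1 / 2"
      and snd: "real_of_int (min (snd s) (snd t)) + 1 / 2 \<le> snd p"
        "snd p \<le> real_of_int (max (snd s) (snd t)) + 1 / 2"
      using assms(1) by (auto simp: center_def closed_segment_eq_real_ivl split: if_splits)
    \<comment> \<open>Rounding down finds the tile around \<open>p\<close>; the offset 1/2 of the
      centers keeps the floor from exceeding the upper end.\<close>
    have "min (snd s) (snd t) \<le> \<lfloor>snd p\<rfloor>" "\<lfloor>snd p\<rfloor> \<le> max (snd s) (snd t)"
      using snd by linarith+
    then have "(fst s, \<lfloor>snd p\<rfloor>) \<in> T"
      by (rule assms(2))
    moreover have "p \<in> square (fst s, \<lfloor>snd p\<rfloor>)"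
      unfolding square_def mem_Times_iff using fst by simp
    ultimately show "p \<in> region T" by blast
  qed
  with assms(1) show ?thesis
    by (simp add: same_column_def center_def)
qed

lemma same_row_region:
  assumes "snd s = snd t"
    and "\<And>k. min (fst s) (fst t) \<le> k \<Longrightarrow> k \<le> max (fst s) (fst t) \<Longrightarrow> (k, snd s) \<in> T"
  shows "same_row (region T) s t"
proof -
  have "closed_segment (center s) (center t) \<subseteq> region T"
  proof
    fix p assume "p \<in> closed_segment (center s) (center t)"
    then have "fst p \<in> closed_segment (fst (center s)) (fst (center t))"
      and "snd p \<in> closed_segment (snd (center s)) (snd (center t))"
      using closed_segment_PairD[of "fst p" "snd p"] by (metis prod.collapse)+
    then have snd: "snd p = real_of_int (snd s) + 1 / 2"
      and fst: "real_of_int (min (fst s) (fst t)) + 1 / 2 \<le> fst p"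
        "fst p \<le> real_of_int (max (fst s) (fst t)) + 1 / 2"
      using assms(1) by (auto simp: center_def closed_segment_eq_real_ivl split: if_splits)
    have "min (fst s) (fst t) \<le> \<lfloor>fst p\<rfloor>" "\<lfloor>fst p\<rfloor> \<le> max (fst s) (fst t)"
      using fst by linarith+
    then have "(\<lfloor>fst p\<rfloor>, snd s) \<in> T"
      by (rule assms(2))
    moreover have "p \<in> square (\<lfloor>fst p\<rfloor>, snd s)"
      unfolding square_def mem_Times_iff using snd by simp
    ultimately show "p \<in> region T" by blast
  qed
  with assms(1) show ?thesis
    by (simp add: same_row_def center_def)
qed

section \<open>The staircase and the polyomino built from it\<close>

definition diagonal :: "nat \<Rightarrow> cell set" where
  "diagonal n = (\<lambda>i. (i, i)) ` {0..<int n}"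

definition staircase :: "nat \<Rightarrow> cell set" where
  "staircase n = diagonal n \<union> (\<lambda>i. (i, i + 1)) ` {0..<int n - 1}"

lemma card_diagonal: "card (diagonal n) = n"
  unfolding diagonal_def by (subst card_image) (auto simp: inj_on_def)

lemma finite_staircase: "finite (staircase n)"
  by (simp add: staircase_def diagonal_def)

lemma card_staircase: "card (staircase n) = 2 * n - 1"
proof -
  have "card ((\<lambda>i::int. (i, i + 1)) ` {0..<int n - 1}) = n - 1"
    by (subst card_image) (auto simp: inj_on_def)
  then show ?thesis
    unfolding staircase_def
    by (subst card_Un_disjoint) (auto simp: card_diagonal, auto simp: diagonal_def)
qed

text \<open>The order of insertion matters: first the cell above the last diagonal cell, then the
  cell to its right, so each new cell is adjacent to an earlier one.\<close>

lemma staircase_Suc: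
  "staircase (Suc (Suc n)) =
    insert (int n + 1, int n + 1) (insert (int n, int n + 1) (staircase (Suc n)))"
  unfolding staircase_def diagonal_def by (auto simp: image_iff)

lemma connected_interior_staircase: "connected (interior (region (staircase (Suc n))))"
proof (induction n)
  case 0
  have "staircase (Suc 0) = {(0, 0)}"
    by (auto simp: staircase_def diagonal_def)
  then show ?case
    by (auto simp: square_def intro!: convex_connected convex_interior convex_Times)
next
  case (Suc n)
  have "(int n, int n) \<in> staircase (Suc n)"
    by (auto simp: staircase_def diagonal_def)
  then have "connected (interior (region (insert (int n, int n + 1) (staircase (Suc n)))))"
    by (intro connected_interior_region_insert[OF Suc.IH]) auto
  then show ?case
    unfolding staircase_Suc
    by (rule connected_interior_region_insert[where c = "(int n, int n + 1)"]) auto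
qed

text \<open>The staircase is one tile short of \<open>2 * m\<close>. For m at least 3, the extra
  cell \<open>(0, 2)\<close> touches \<open>(0, 1)\<close> and \<open>(1, 2)\<close>, so it opens no
  gap in column 0 or row 2, and it lies above the diagonal.\<close>

definition cells :: "nat \<Rightarrow> cell set" where
  "cells m = insert (0, 2) (staircase m)"

text \<open>Two bounds suffice because i \<le> j in each of the three cases. The linear form lets
  \<open>linarith\<close> check that runs have no gaps.\<close>

lemma mem_cells_iff:
  assumes "m \<ge> 3"
  shows "(i, j) \<in> cells m \<longleftrightarrow>
    0 \<le> i \<and> j < int m \<and> (j = i \<or> j = i + 1 \<or> i = 0 \<and> j = 2)"
  using assms by (auto simp: cells_def staircase_def diagonal_def image_iff)

lemma polyomino_cells:
  assumes "m \<ge> 3"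
  shows "polyomino (region (cells m))"
proof -
  obtain n where m: "m = Suc n"
    using assms by (cases m) auto
  have "connected (interior (region (cells m)))"
    unfolding cells_def m using assms m
    by (intro connected_interior_region_insert[where c = "(0, 1)"] connected_interior_staircase)
      (auto simp: staircase_def)
  then show ?thesis
    unfolding polyomino_def
    by (intro conjI exI[of _ "cells m"]) (auto simp: cells_def finite_staircase)
qed

lemma card_cells:
  assumes "m \<ge> 3"
  shows "card (cells m) = 2 * m"
proof -
  have "(0, 2) \<notin> staircase m"
    by (auto simp: staircase_def diagonal_def)
  then show ?thesis
    unfolding cells_def using assms by (simp add: finite_staircase card_staircase)
qed

section \<open>Rook placements and uniqueness\<close>

lemma nonattacking_cells_iff:
  assumes "m \<ge> 3"
  shows "nonattacking (region (cells m)) R \<longleftrightarrow>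
    R \<subseteq> cells m \<and> inj_on fst R \<and> inj_on snd R"
proof
  assume R: "nonattacking (region (cells m)) R"
  then have sub: "R \<subseteq> cells m"
    by (simp add: nonattacking_def tiles_region)
  have "s = t" if st: "s \<in> R" "t \<in> R" "fst s = fst t" for s t
  proof (rule ccontr)
    have mem: "(fst s, snd s) \<in> cells m" "(fst s, snd t) \<in> cells m"
      using st sub by (metis prod.collapse subsetD)+
    have "(fst s, k) \<in> cells m"
      if "min (snd s) (snd t) \<le> k" "k \<le> max (snd s) (snd t)" for k
      using mem that unfolding mem_cells_iff[OF assms] by linarith
    then have "same_column (region (cells m)) s t"
      by (intro same_column_region st)
    moreover assume "s \<noteq> t"
    ultimately show False
      using R st by (auto simp: nonattacking_def)
  qed
  moreover have "s = t" if st: "s \<in> R" "t \<in> R" "snd s = snd t" for s t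
  proof (rule ccontr)
    have mem: "(fst s, snd s) \<in> cells m" "(fst t, snd s) \<in> cells m"
      using st sub by (metis prod.collapse subsetD)+
    \<comment> \<open>Row j meets only columns j - 1 and j, except that row 2 also has column 0,
      which is next to column 1.\<close>
    have "(k, snd s) \<in> cells m"
      if "min (fst s) (fst t) \<le> k" "k \<le> max (fst s) (fst t)" for k
      using mem that unfolding mem_cells_iff[OF assms] by linarith
    then have "same_row (region (cells m)) s t"
      by (intro same_row_region st)
    moreover assume "s \<noteq> t"
    ultimately show False
      using R st by (auto simp: nonattacking_def)
  qed
  ultimately show "R \<subseteq> cells m \<and> inj_on fst R \<and> inj_on snd R"
    using sub by (auto simp: inj_on_def)
next
  assume "R \<subseteq> cells m \<and> inj_on fst R \<and> inj_on snd R"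
  then show "nonattacking (region (cells m)) R"
    unfolding nonattacking_def tiles_region same_row_def same_column_def
    by (auto simp: center_def inj_on_def)
qed

text \<open>Instead of an induction over columns, a sum is used: the differences
  \<open>snd s - fst s\<close> are nonnegative and add up to zero, so all of them vanish.\<close>

lemma eq_diagonal:
  assumes "m \<ge> 3" and sub: "R \<subseteq> cells m" and inj: "inj_on fst R" "inj_on snd R"
    and card: "card R = m"
  shows "R = diagonal m"
proof -
  have bounds: "0 \<le> fst s \<and> fst s \<le> snd s \<and> snd s < int m" if "s \<in> R" for s
    using that sub mem_cells_iff[OF assms(1), of "fst s" "snd s"] by auto
  \<comment> \<open>By injectivity each projection takes m distinct values in an interval of m
    integers and so fills it.\<close>
  have "fst ` R = {0..<int m}" "snd ` R = {0..<int m}"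
    using bounds by (intro card_subset_eq; force simp: card_image inj card)+
  \<comment> \<open>Both coordinates run through \<open>{0..<int m}\<close>, hence have equal sums over \<open>R\<close>.\<close>
  then have "(\<Sum>s\<in>R. fst s) = (\<Sum>s\<in>R. snd s)"
    using sum.reindex[OF inj(1), of id] sum.reindex[OF inj(2), of id] by simp
  then have "(\<Sum>s\<in>R. snd s - fst s) = 0"
    by (simp add: sum_subtractf)
  \<comment> \<open>Infinite sets have \<open>card\<close> 0, whereas m is positive.\<close>
  moreover have fin: "finite R"
    using card assms(1) by (intro card_ge_0_finite) simp
  ultimately have "\<forall>s\<in>R. snd s - fst s = 0"
    using bounds by (subst (asm) sum_nonneg_eq_0_iff) auto
  then have "R \<subseteq> diagonal m"
    using bounds by (force simp: diagonal_def)
  then show ?thesis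
    by (intro card_subset_eq) (auto simp: card card_diagonal, simp add: diagonal_def)
qed

theorem theorem20:
  fixes m :: nat
  assumes "m \<ge> 3"
  shows "\<exists>P. polyomino P \<and> card (tiles P) = 2 * m
           \<and> (\<exists>!R. nonattacking P R \<and> card R = m)"
proof (intro exI conjI)
  show "polyomino (region (cells m))"
    by (rule polyomino_cells[OF assms])
  show "card (tiles (region (cells m))) = 2 * m"
    by (simp add: tiles_region card_cells assms)
  have "diagonal m \<subseteq> cells m" "inj_on fst (diagonal m)" "inj_on snd (diagonal m)"
    by (auto simp: cells_def staircase_def diagonal_def inj_on_def)
  then show "\<exists>!R. nonattacking (region (cells m)) R \<and> card R = m"
    unfolding nonattacking_cells_iff[OF assms]
    by (intro ex1I[of _ "diagonal m"]) (simp_all add: card_diagonal eq_diagonal[OF assms])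
qed

end
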